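(* Let $l_1,m_1,k_1,l_2,m_2,k_2$ be integers with $|l_i|\geqslant m_i>0$ and $k_i>0$ for $i=1,2$, and let $G_1=G(l_1,m_1;k_1)$, $G_2=G(l_2,m_2;k_2)$. Suppose that $G_1$ is a homomorphic image of $G_2$ and $G_2$ is a homomorphic image of $G_1$, and that at least one of the inequalities $|l_1|>m_1$, $|l_2|>m_2$ holds. Then $l_1=l_2$ and $m_1=m_2$.
   Context: For nonzero integers $l,m,k$, $G(l,m;k)$ denotes the one-relator group $\langle a,t \mid t^{-1}a^{-k}ta^{l}t^{-1}a^{k}t=a^{m}\rangle$. *)

theory Defs
  imports "HOL-Algebra.Group"
begin

datatype gen = GA | GT

text \<open>A letter is (b, x): b = False means x, b = True means x inverse.\<close>
type_synonym word = "(bool \<times> gen) list"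

definition inv_word :: "word \<Rightarrow> word" where
  "inv_word w = rev (map (\<lambda>(b, x). (\<not> b, x)) w)"

definition pow_word :: "word \<Rightarrow> int \<Rightarrow> word" where
  "pow_word w n = (if 0 \<le> n then concat (replicate (nat n) w)
                   else concat (replicate (nat (- n)) (inv_word w)))"

definition wa :: word where "wa = [(False, GA)]"
definition wt :: word where "wt = [(False, GT)]"

text \<open>Relator of t^-1 a^-k t a^l t^-1 a^k t = a^m, i.e. LHS * a^-m.\<close>
definition relator :: "int \<Rightarrow> int \<Rightarrow> int \<Rightarrow> word" where
  "relator l m k = inv_word wt @ pow_word wa (- k) @ wt @ pow_word wa l @
                   inv_word wt @ pow_word wa k @ wt @ pow_word wa (- m)"

inductive_set word_eqv :: "word set \<Rightarrow> (word \<times> word) set" for R :: "word set" where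
  refl: "(u, u) \<in> word_eqv R"
| sym: "(u, v) \<in> word_eqv R \<Longrightarrow> (v, u) \<in> word_eqv R"
| trans: "(u, v) \<in> word_eqv R \<Longrightarrow> (v, w) \<in> word_eqv R \<Longrightarrow> (u, w) \<in> word_eqv R"
| cancel: "(u @ [(b, x), (\<not> b, x)] @ v, u @ v) \<in> word_eqv R"
| relat: "r \<in> R \<Longrightarrow> (u @ r @ v, u @ v) \<in> word_eqv R"

definition presented_group :: "word set \<Rightarrow> word set monoid" where
  "presented_group R =
     \<lparr> carrier = UNIV // word_eqv R,
       mult = (\<lambda>X Y. word_eqv R `` {(SOME x. x \<in> X) @ (SOME y. y \<in> Y)}),
       one = word_eqv R `` {[]} \<rparr>"

definition G :: "int \<Rightarrow> int \<Rightarrow> int \<Rightarrow> word set monoid" where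
  "G l m k = presented_group {relator l m k}"

definition homomorphic_image :: "('a, 'c) monoid_scheme \<Rightarrow> ('b, 'd) monoid_scheme \<Rightarrow> bool" where
  "homomorphic_image H K \<longleftrightarrow> (\<exists>h \<in> hom K H. h ` carrier K = carrier H)"

end

theory Submission
  imports Defs Complex_Main
begin

text \<open>Put \<open>r = l / m\<close>. In \<open>\<int> \<ltimes> \<rat>\<close>, where \<open>1 \<in> \<int>\<close> acts on \<open>\<rat>\<close> as multiplication by \<open>r\<close>, the elements
  \<open>a = (0, 1 / k)\<close> and \<open>b = (1, 0)\<close> satisfy \<open>b\<^sup>-\<^sup>1 a\<^sup>l b = a\<^sup>m\<close>, so \<open>G(l, m; k)\<close> maps onto a non-abelian subgroup
  of the HNN extension of \<open>\<int> \<ltimes> \<rat>\<close> with stable letter \<open>t\<close> and \<open>t\<^sup>-\<^sup>1 a\<^sup>k t = b\<close>. There, if \<open>x \<noteq> 1\<close> and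
  \<open>x\<^sup>p\<close> is conjugate to \<open>x\<^sup>q\<close> with \<open>\<bar>p\<bar> > \<bar>q\<bar> > 0\<close>, then \<open>x\<close> is conjugate into the base by a length
  comparison, and a class function on the base which is invariant under \<open>a\<^sup>k \<mapsto> b\<close> shows that \<open>p / q\<close>
  is a power of \<open>r\<close>. Applied to the images of the generator \<open>a\<close> under both epimorphisms, this makes
  \<open>l\<^sub>1 / m\<^sub>1\<close> and \<open>l\<^sub>2 / m\<^sub>2\<close> powers of each other, hence equal, while the abelianisations give
  \<open>\<bar>l\<^sub>1 - m\<^sub>1\<bar> = \<bar>l\<^sub>2 - m\<^sub>2\<bar>\<close>.\<close>

section \<open>Integer multiples in additively written groups\<close>

lemmas group_simps = add.assoc minus_add minus_minus diff_conv_add_uminus add_minus_cancel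
  minus_add_cancel add_0_left add_0_right left_minus right_minus minus_zero

text \<open>The class \<open>group_add\<close> does not assume commutativity, so this is the power
  x^n in an arbitrary group written additively, and \<open>- z + x + z\<close> is the conjugate of
  \<open>x\<close> by \<open>z\<close>.\<close>

definition zpow :: "'a::group_add \<Rightarrow> int \<Rightarrow> 'a" where
  "zpow x n = (if 0 \<le> n then ((+) x ^^ nat n) 0 else ((+) (- x) ^^ nat (- n)) 0)"

lemma zpow_0 [simp]: "zpow x 0 = 0"
  by (simp add: zpow_def)

lemma zpow_Suc: "zpow x (n + 1) = x + zpow x n"
proof (cases "0 \<le> n")
  case True
  then show ?thesis by (simp add: zpow_def nat_add_distrib)
next
  case False
  define k where "k = nat (- n - 1)"
  have k: "nat (- n) = Suc k" "nat (- (n + 1)) = k" and n: "0 \<le> n + 1 \<Longrightarrow> k = 0"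
    using False by (simp_all add: k_def)
  have "zpow x n = - x + ((+) (- x) ^^ k) 0"
    using False by (simp add: zpow_def k(1))
  moreover have "zpow x (n + 1) = ((+) (- x) ^^ k) 0"
  proof (cases "0 \<le> n + 1")
    case True
    then have "n + 1 = 0" using False by linarith
    then show ?thesis using n[OF True] by simp
  next
    case False
    then show ?thesis by (simp only: zpow_def k(2) if_False)
  qed
  ultimately show ?thesis by (simp only: add_minus_cancel)
qed

lemma zpow_pred: "zpow x (n - 1) = - x + zpow x n"
  by (metis zpow_Suc diff_add_cancel minus_add_cancel)

lemma zpow_1 [simp]: "zpow x 1 = x"
  using zpow_Suc[of x 0] by simp

lemma zpow_add: "zpow x (m + n) = zpow x m + zpow x n"
proof (induction m rule: int_induct[where k = 0])
  case base
  then show ?case by simp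
next
  case (step1 i)
  have "zpow x (i + 1 + n) = zpow x ((i + n) + 1)" by (simp add: add_ac)
  then show ?case using step1 by (simp only: zpow_Suc) (simp add: add.assoc)
next
  case (step2 i)
  have "zpow x (i - 1 + n) = zpow x ((i + n) - 1)" by (simp add: algebra_simps)
  then show ?case using step2 by (simp only: zpow_pred) (simp add: add.assoc)
qed

lemma zpow_minus: "zpow x (- n) = - zpow x n"
proof -
  have "zpow x n + zpow x (- n) = zpow x (n + - n)" by (rule zpow_add[symmetric])
  then have "zpow x n + zpow x (- n) = 0" by simp
  then show ?thesis by (rule minus_unique[symmetric])
qed

lemma zpow_mult: "zpow x (m * n) = zpow (zpow x m) n"
proof (induction n rule: int_induct[where k = 0])
  case base
  then show ?case by simp
next
  case (step1 i)
  have "zpow x (m * (i + 1)) = zpow x (m + m * i)" by (simp add: algebra_simps)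
  also have "\<dots> = zpow x m + zpow (zpow x m) i" by (simp only: zpow_add step1)
  finally show ?case by (simp only: zpow_Suc)
next
  case (step2 i)
  have "zpow x (m * (i - 1)) = zpow x (- m + m * i)" by (simp add: algebra_simps)
  also have "\<dots> = - zpow x m + zpow (zpow x m) i" by (simp only: zpow_add zpow_minus step2)
  finally show ?case by (simp only: zpow_pred)
qed

lemma zpow_conj: "zpow (- z + x + z) n = - z + zpow x n + z"
proof (induction n rule: int_induct[where k = 0])
  case base
  then show ?case by simp
next
  case (step1 i)
  then show ?case by (simp only: zpow_Suc) (simp add: add.assoc)
next
  case (step2 i)
  show ?case unfolding zpow_pred step2(2) by (simp only: group_simps)
qed

lemma zpow_zero [simp]: "zpow 0 n = 0"
  by (metis mult_zero_left zpow_0 zpow_mult)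

lemma zpow_int: "zpow x n = n * x" for x :: int
proof (induction n rule: int_induct[where k = 0])
  case base
  then show ?case by simp
next
  case (step1 i)
  then show ?case by (simp only: zpow_Suc) (simp add: algebra_simps)
next
  case (step2 i)
  then show ?case by (simp only: zpow_pred) (simp add: algebra_simps)
qed

lemma zpow_replicate: "sum_list (concat (replicate n xs)) = zpow (sum_list xs) (int n)"
proof (induction n)
  case (Suc n)
  have "zpow (sum_list xs) (int (Suc n)) = sum_list xs + zpow (sum_list xs) (int n)"
    using zpow_Suc[of "sum_list xs" "int n"] by (simp add: add.commute)
  then show ?case using Suc by (simp del: of_nat_Suc)
qed simp

text \<open>Conjugation by z^i produces x^(q^i p) = (x^p)^(q^i), and one further \<open>z\<close>
  turns this into (x^q)^(q^i).\<close>

lemma zpow_conj_iterate: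
  assumes "- z + zpow x p + z = zpow x q"
  shows "- zpow z (int i) + zpow x (p ^ i) + zpow z (int i) = zpow x (q ^ i)"
proof (induction i)
  case 0
  then show ?case by simp
next
  case (Suc i)
  have z: "zpow z (int (Suc i)) = zpow z (int i) + z"
    using zpow_add[of z "int i" 1] by (simp add: add.commute)
  have x: "zpow x (p ^ Suc i) = zpow (zpow x (p ^ i)) p"
    using zpow_mult[of x "p ^ i" p] by (simp add: mult.commute)
  have "- zpow z (int (Suc i)) + zpow x (p ^ Suc i) + zpow z (int (Suc i))
      = - z + (- zpow z (int i) + zpow (zpow x (p ^ i)) p + zpow z (int i)) + z"
    unfolding z x by (simp only: group_simps)
  also have "- zpow z (int i) + zpow (zpow x (p ^ i)) p + zpow z (int i) = zpow (zpow x (q ^ i)) p"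
    using Suc by (metis zpow_conj)
  also have "zpow (zpow x (q ^ i)) p = zpow (zpow x p) (q ^ i)"
    by (simp only: zpow_mult[symmetric] mult.commute)
  also have "- z + zpow (zpow x p) (q ^ i) + z = zpow (zpow x q) (q ^ i)"
    using assms by (metis zpow_conj)
  also have "\<dots> = zpow x (q ^ Suc i)"
    by (simp only: zpow_mult[symmetric] power_Suc)
  finally show ?case .
qed

section \<open>Words\<close>

fun letter_val :: "'a::group_add \<Rightarrow> 'a \<Rightarrow> bool \<times> gen \<Rightarrow> 'a" where
  "letter_val a t (b, GA) = (if b then - a else a)"
| "letter_val a t (b, GT) = (if b then - t else t)"

definition word_val :: "'a::group_add \<Rightarrow> 'a \<Rightarrow> word \<Rightarrow> 'a" where
  "word_val a t w = sum_list (map (letter_val a t) w)"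

lemma word_val_Nil [simp]: "word_val a t [] = 0"
  and word_val_append [simp]: "word_val a t (u @ v) = word_val a t u + word_val a t v"
  and word_val_Cons: "word_val a t (x # v) = letter_val a t x + word_val a t v"
  by (simp_all add: word_val_def)

lemma letter_val_neg: "letter_val a t (\<not> b, x) = - letter_val a t (b, x)"
  by (cases x) auto

lemma word_val_wa [simp]: "word_val a t wa = a" and word_val_wt [simp]: "word_val a t wt = t"
  by (simp_all add: wa_def wt_def word_val_def)

lemma inv_word_Nil [simp]: "inv_word [] = []"
  and inv_word_Cons: "inv_word ((b, x) # v) = inv_word v @ [(\<not> b, x)]"
  by (simp_all add: inv_word_def)

lemma word_val_inv [simp]: "word_val a t (inv_word w) = - word_val a t w"
proof (induction w)
  case (Cons y w)
  then show ?case
    by (cases y) (simp add: inv_word_Cons word_val_Cons letter_val_neg minus_add)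
qed simp

lemma word_val_pow [simp]: "word_val a t (pow_word w n) = zpow (word_val a t w) n"
proof -
  have *: "word_val a t (concat (replicate k w)) = ((+) (word_val a t w) ^^ k) 0" for k w
    by (induction k) simp_all
  show ?thesis by (simp add: pow_word_def zpow_def *)
qed

text \<open>With b = t^-1 a^k t the relator reads b^-1 a^l b a^-m, so it vanishes exactly when b
  conjugates a^l to a^m.\<close>

lemma word_val_relator:
  "word_val a t (relator l m k) =
     - (- t + zpow a k + t) + zpow a l + (- t + zpow a k + t) - zpow a m"
  by (simp only: relator_def word_val_append word_val_inv word_val_pow word_val_wa word_val_wt
      zpow_minus group_simps)

lemma word_val_eqv:
  assumes "(u, v) \<in> word_eqv R" "\<And>r. r \<in> R \<Longrightarrow> word_val a t r = 0"
  shows "word_val a t u = word_val a t v"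
  using assms(1)
proof induction
  case (cancel u b x v)
  have "letter_val a t (b, x) + (letter_val a t (\<not> b, x) + y) = y" for y
    by (simp only: letter_val_neg) (simp add: add.assoc[symmetric])
  then show ?case by (simp add: word_val_Cons)
qed (auto simp: assms(2))

fun letter_subst :: "word \<Rightarrow> word \<Rightarrow> bool \<times> gen \<Rightarrow> word" where
  "letter_subst u v (b, GA) = (if b then inv_word u else u)"
| "letter_subst u v (b, GT) = (if b then inv_word v else v)"

text \<open>Models a homomorphism on words, given the images \<open>u\<close> of a and
  \<open>v\<close> of t.\<close>

definition word_subst :: "word \<Rightarrow> word \<Rightarrow> word \<Rightarrow> word" where
  "word_subst u v w = concat (map (letter_subst u v) w)"

lemma word_val_subst:
  "word_val a t (word_subst u v w) = word_val (word_val a t u) (word_val a t v) w"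
proof (induction w)
  case (Cons y w)
  have "word_val a t (letter_subst u v y) = letter_val (word_val a t u) (word_val a t v) y"
    by (cases "(u, v, y)" rule: letter_subst.cases) simp_all
  then show ?case using Cons by (simp add: word_subst_def word_val_Cons)
qed (simp add: word_subst_def)

section \<open>Epimorphisms between presented groups\<close>

lemma equiv_word_eqv: "equiv UNIV (word_eqv R)"
  by (rule equivI) (auto simp: refl_on_def sym_def trans_def intro: word_eqv.intros)

lemma word_eqv_context:
  assumes "(u, v) \<in> word_eqv R"
  shows "(p @ u @ q, p @ v @ q) \<in> word_eqv R"
  using assms
proof induction
  case (cancel u b x v)
  then show ?case using word_eqv.cancel[of "p @ u" b x "v @ q" R] by simp
next
  case (relat r u v)
  then show ?case using word_eqv.relat[of r R "p @ u" "v @ q"] by simp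
qed (auto intro: word_eqv.intros)

lemma word_eqv_append:
  assumes "(u, u') \<in> word_eqv R" "(v, v') \<in> word_eqv R"
  shows "(u @ v, u' @ v') \<in> word_eqv R"
  using word_eqv_context[OF assms(1), of "[]" v] word_eqv_context[OF assms(2), of u' "[]"]
  by simp (rule word_eqv.trans)

lemma word_eqv_inv_right: "(w @ inv_word w, []) \<in> word_eqv R"
proof (induction w)
  case Nil
  then show ?case by (simp add: word_eqv.refl)
next
  case (Cons y w)
  obtain b x where y: "y = (b, x)" by force
  show ?case
    using word_eqv_context[OF Cons, of "[y]" "[(\<not> b, x)]"] word_eqv.cancel[of "[]" b x "[]" R]
    by (simp add: y inv_word_Cons) (rule word_eqv.trans)
qed

lemma word_eqv_cancel_right:
  assumes "(u @ w, v @ w) \<in> word_eqv R"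
  shows "(u, v) \<in> word_eqv R"
proof -
  have "(u @ w @ inv_word w, v @ w @ inv_word w) \<in> word_eqv R"
    using word_eqv_context[OF assms, of "[]" "inv_word w"] by simp
  moreover have "(x @ w @ inv_word w, x) \<in> word_eqv R" for x
    using word_eqv_context[OF word_eqv_inv_right, of x w "[]"] by simp
  ultimately show ?thesis by (meson word_eqv.sym word_eqv.trans)
qed

lemma word_eqv_inv_unique:
  assumes "(u @ w, []) \<in> word_eqv R"
  shows "(u, inv_word w) \<in> word_eqv R"
proof -
  have "(inv_word w @ w, []) \<in> word_eqv R"
    using word_eqv_inv_right[of "inv_word w" R]
    by (simp add: inv_word_def rev_map comp_def case_prod_beta)
  then show ?thesis
    using assms word_eqv_cancel_right by (meson word_eqv.sym word_eqv.trans)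
qed

abbreviation word_class :: "word set \<Rightarrow> word \<Rightarrow> word set" where
  "word_class R w \<equiv> word_eqv R `` {w}"

lemma word_class_eq_iff: "word_class R u = word_class R v \<longleftrightarrow> (u, v) \<in> word_eqv R"
  using eq_equiv_class_iff[OF equiv_word_eqv] by auto

text \<open>The product of classes is defined through chosen representatives; this lets it be
  computed on any representatives.\<close>

lemma some_word_class: "(u, SOME x. x \<in> word_class R u) \<in> word_eqv R"
  using someI[of "\<lambda>x. x \<in> word_class R u" u] by (simp add: word_eqv.refl)

lemma carrier_presented: "carrier (presented_group R) = range (word_class R)"
  by (auto simp: presented_group_def quotient_def)

lemma mult_presented:
  "word_class R u \<otimes>\<^bsub>presented_group R\<^esub> word_class R v = word_class R (u @ v)"
  using word_eqv_append[OF some_word_class some_word_class, THEN word_eqv.sym]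
  by (simp add: presented_group_def word_class_eq_iff)

text \<open>Choosing a representative of the image of every class turns a homomorphism into a map
  \<phi> on words that is multiplicative up to equivalence. By induction on words it agrees, up to
  equivalence, with substitution of the images of the two generators.\<close>

lemma presented_epi_words:
  assumes "homomorphic_image (presented_group R) (presented_group S)"
  obtains u v where "\<And>r. r \<in> S \<Longrightarrow> (word_subst u v r, []) \<in> word_eqv R"
    and "\<And>w. \<exists>w'. (w, word_subst u v w') \<in> word_eqv R"
proof -
  obtain h where h: "h \<in> hom (presented_group S) (presented_group R)"
    and surj: "h ` carrier (presented_group S) = carrier (presented_group R)"
    using assms by (auto simp: homomorphic_image_def)
  define \<phi> where "\<phi> w = (SOME x. h (word_class S w) = word_class R x)" for w
  have \<phi>: "h (word_class S w) = word_class R (\<phi> w)" for w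
  proof -
    have "h (word_class S w) \<in> range (word_class R)"
      using hom_in_carrier[OF h, of "word_class S w"] by (simp add: carrier_presented)
    then have "\<exists>x. h (word_class S w) = word_class R x" by blast
    then show ?thesis unfolding \<phi>_def by (rule someI_ex)
  qed
  have \<phi>_append: "(\<phi> (x @ y), \<phi> x @ \<phi> y) \<in> word_eqv R" for x y
    using hom_mult[OF h, unfolded carrier_presented, OF rangeI rangeI, of x y]
    by (simp add: mult_presented \<phi> word_class_eq_iff)
  have \<phi>_cong: "(\<phi> x, \<phi> y) \<in> word_eqv R" if "(x, y) \<in> word_eqv S" for x y
    using that by (metis \<phi> word_class_eq_iff)
  \<comment> \<open>Membership in \<open>hom\<close> only gives multiplicativity: \<phi> of the
    empty word is idempotent up to equivalence, hence trivial by cancellation.\<close>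
  have \<phi>_Nil: "(\<phi> [], []) \<in> word_eqv R"
    using word_eqv_cancel_right[of "[]" "\<phi> []" "\<phi> []"] \<phi>_append[of "[]" "[]"]
    by (simp add: word_eqv.sym)
  have \<phi>_neg: "(\<phi> [(True, x)], inv_word (\<phi> [(False, x)])) \<in> word_eqv R" for x
  proof (rule word_eqv_inv_unique)
    have "(\<phi> [(True, x), (False, x)], []) \<in> word_eqv R"
      using \<phi>_cong[OF word_eqv.cancel[of "[]" True x "[]"]] \<phi>_Nil by simp (rule word_eqv.trans)
    then show "(\<phi> [(True, x)] @ \<phi> [(False, x)], []) \<in> word_eqv R"
      using \<phi>_append[of "[(True, x)]" "[(False, x)]"] by simp (meson word_eqv.sym word_eqv.trans)
  qed
  let ?s = "word_subst (\<phi> wa) (\<phi> wt)"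
  have letter: "(\<phi> [y], letter_subst (\<phi> wa) (\<phi> wt) y) \<in> word_eqv R" for y
  proof -
    obtain b x where y: "y = (b, x)" by force
    show ?thesis
      using \<phi>_neg[of x] by (cases x; cases b) (auto simp: y wa_def wt_def word_eqv.refl)
  qed
  have subst: "(\<phi> w, ?s w) \<in> word_eqv R" for w
  proof (induction w)
    case Nil
    then show ?case by (simp add: word_subst_def \<phi>_Nil)
  next
    case (Cons y w)
    then show ?case
      using \<phi>_append[of "[y]" w] word_eqv_append[OF letter[of y] Cons]
      by (simp add: word_subst_def) (rule word_eqv.trans)
  qed
  show ?thesis
  proof
    fix r assume "r \<in> S"
    then have "(r, []) \<in> word_eqv S" using word_eqv.relat[of r S "[]" "[]"] by simp
    then show "(?s r, []) \<in> word_eqv R"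
      using \<phi>_cong \<phi>_Nil subst by (meson word_eqv.sym word_eqv.trans)
  next
    fix w
    have "word_class R w \<in> h ` range (word_class S)"
      using surj by (auto simp: carrier_presented)
    then obtain w' where "word_class R w = h (word_class S w')" by auto
    then have "(w, \<phi> w') \<in> word_eqv R" by (simp add: \<phi> word_class_eq_iff)
    then show "\<exists>w'. (w, ?s w') \<in> word_eqv R" using subst by (meson word_eqv.trans)
  qed
qed

section \<open>Abelianisation\<close>

text \<open>In the integers, \<open>word_val 1 0\<close> and \<open>word_val 0 1\<close> are the
  exponent sums of a and of t.\<close>

lemma word_val_int: "word_val x y w = x * word_val 1 0 w + y * word_val 0 1 w" for x y :: int
proof (induction w)
  case (Cons z w)
  have "letter_val x y z = x * letter_val 1 0 z + y * letter_val 0 1 z"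
    by (cases "(x, y, z)" rule: letter_val.cases) auto
  then show ?case using Cons by (simp add: word_val_Cons algebra_simps)
qed simp

lemma word_val_int_relator: "word_val x y (relator l m k) = (l - m) * x" for x y :: int
  by (simp add: word_val_relator zpow_int algebra_simps)

text \<open>The abelianisation is Z/(l - m) times Z: inserting or deleting the relator changes the
  exponent sum of a by l - m up to sign and leaves that of t alone.\<close>

lemma word_eqv_exponent_sums:
  assumes "(u, v) \<in> word_eqv {relator l m k}"
  shows "word_val 0 1 u = (word_val 0 1 v :: int)"
    and "l - m dvd word_val 1 0 u - (word_val 1 0 v :: int)"
proof -
  show "word_val 0 1 u = (word_val 0 1 v :: int)"
    by (rule word_val_eqv[OF assms]) (simp add: word_val_int_relator)
  show "l - m dvd word_val 1 0 u - (word_val 1 0 v :: int)"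
    using assms
  proof induction
    case (sym u v)
    then show ?case by (simp add: dvd_diff_commute)
  next
    case (trans u v w)
    then show ?case using dvd_add[of "l - m" "word_val 1 0 u - word_val 1 0 v" "word_val 1 0 v - word_val 1 0 w"]
      by simp
  next
    case (cancel u b x v)
    then show ?case by (simp add: word_val_Cons letter_val_neg)
  next
    case (relat r u v)
    then show ?case by (simp add: word_val_int_relator)
  qed simp
qed

text \<open>If l2 differs from m2, the relation forces the image of a to have t-exponent 0 and an
  a-exponent \<open>x2\<close> with (l2 - m2) \<open>x2\<close> divisible by l1 - m1. Surjectivity
  makes \<open>x2\<close> invertible modulo l1 - m1.\<close>

lemma epi_abelianisation:
  assumes "homomorphic_image (G l1 m1 k1) (G l2 m2 k2)"
  shows "l1 - m1 dvd l2 - m2"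
proof (cases "l2 = m2")
  case False
  obtain u v where rel: "\<And>r. r \<in> {relator l2 m2 k2} \<Longrightarrow> (word_subst u v r, []) \<in> word_eqv {relator l1 m1 k1}"
    and surj: "\<And>w. \<exists>w'. (w, word_subst u v w') \<in> word_eqv {relator l1 m1 k1}"
    using presented_epi_words assms unfolding G_def by metis
  define x1 x2 y1 y2 :: int where "x1 = word_val 0 1 u" and "x2 = word_val 1 0 u"
    and "y1 = word_val 0 1 v" and "y2 = word_val 1 0 v"
  have sub: "word_val 0 1 (word_subst u v w) = x1 * word_val 1 0 w + y1 * word_val 0 1 w"
    "word_val 1 0 (word_subst u v w) = x2 * word_val 1 0 w + y2 * word_val 0 1 w" for w
    using word_val_int[of x1 y1 w] word_val_int[of x2 y2 w]
    by (simp_all add: word_val_subst x1_def x2_def y1_def y2_def)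
  have "(l2 - m2) * x1 = 0" and x2: "l1 - m1 dvd (l2 - m2) * x2"
    using word_eqv_exponent_sums[OF rel[OF singletonI]]
    by (simp_all add: sub word_val_int_relator mult.commute)
  then have x1: "x1 = 0" using False by simp
  obtain w where "(wt, word_subst u v w) \<in> word_eqv {relator l1 m1 k1}"
    using surj by blast
  \<comment> \<open>The word \<open>w\<close> maps to t, whose t-exponent 1 must be a multiple of
    \<open>y1\<close>.\<close>
  from word_eqv_exponent_sums(1)[OF this] have "y1 \<noteq> 0" by (auto simp: sub x1)
  obtain w' where "(wa, word_subst u v w') \<in> word_eqv {relator l1 m1 k1}"
    using surj by blast
  from word_eqv_exponent_sums[OF this] have "y1 * word_val 0 1 w' = 0"
    and "l1 - m1 dvd 1 - (x2 * word_val 1 0 w' + y2 * word_val 0 1 w')"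
    by (auto simp: sub x1)
  \<comment> \<open>The word \<open>w'\<close> maps to a, so its t-exponent is 0 and the term with
    \<open>y2\<close> drops out.\<close>
  with \<open>y1 \<noteq> 0\<close> have "l1 - m1 dvd 1 - x2 * word_val 1 0 w'" by simp
  then have "l1 - m1 dvd (l2 - m2) * (1 - x2 * word_val 1 0 w')" by (rule dvd_mult)
  moreover have "l1 - m1 dvd (l2 - m2) * x2 * word_val 1 0 w'" using x2 by (rule dvd_mult2)
  ultimately have "l1 - m1 dvd (l2 - m2) * (1 - x2 * word_val 1 0 w') + (l2 - m2) * x2 * word_val 1 0 w'"
    by (rule dvd_add)
  then show ?thesis by (simp add: algebra_simps)
qed simp

section \<open>Permutation groups\<close>

text \<open>The HNN extension is realised by permutations of pairs that stand for normal forms; as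
  an instance of \<open>group_add\<close>, permutations admit \<open>zpow\<close> and
  \<open>word_val\<close>.\<close>

typedef 'a perm = "{f :: 'a \<Rightarrow> 'a. bij f}" morphisms papp Perm
  by (auto intro: bij_id)

lemma papp_Perm: "bij f \<Longrightarrow> papp (Perm f) = f"
  by (simp add: Perm_inverse)

lemma bij_papp: "bij (papp p)"
  using papp by auto

instantiation perm :: (type) group_add
begin

definition "0 = Perm id"
definition "p + q = Perm (papp p \<circ> papp q)"
definition "- p = Perm (inv_into UNIV (papp p))"
definition "p - q = p + - q" for p q :: "'a perm"

lemma papp_zero [simp]: "papp 0 x = x"
  by (simp add: zero_perm_def papp_Perm)

lemma papp_plus [simp]: "papp (p + q) x = papp p (papp q x)"
  by (simp add: plus_perm_def papp_Perm bij_papp bij_comp)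

lemma papp_uminus: "papp (- p) = inv_into UNIV (papp p)"
  by (simp add: uminus_perm_def papp_Perm bij_papp bij_imp_bij_inv)

lemma perm_eqI: "(\<And>x. papp p x = papp q x) \<Longrightarrow> p = q"
  by (metis papp_inject ext)

instance
proof
  fix p q r :: "'a perm"
  show "p + q + r = p + (q + r)" "0 + p = p" "p + 0 = p" "p + - q = p - q"
    by (auto intro!: perm_eqI simp: minus_perm_def)
  show "- p + p = 0"
    by (rule perm_eqI) (simp add: papp_uminus bij_papp bij_is_inj)
qed

end

section \<open>The semidirect product of \<open>\<int>\<close> and \<open>\<rat>\<close>\<close>

type_synonym aff = "int \<times> rat"
type_synonym syllable = "bool \<times> aff"

locale hnn_affine =
  fixes r :: rat
  assumes r_nonzero: "r \<noteq> 0"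
begin

definition amul :: "aff \<Rightarrow> aff \<Rightarrow> aff"  (infixl "\<odot>" 70) where
  "g \<odot> h = (fst g + fst h, snd g + r powi fst g * snd h)"

definition ainv :: "aff \<Rightarrow> aff" where
  "ainv g = (- fst g, - (r powi (- fst g) * snd g))"

abbreviation aone :: aff where "aone \<equiv> (0, 0)"

lemma amul_assoc: "g \<odot> h \<odot> k = g \<odot> (h \<odot> k)"
  using r_nonzero by (simp add: amul_def power_int_add algebra_simps)

lemma amul_one [simp]: "aone \<odot> g = g" "g \<odot> aone = g"
  by (simp_all add: amul_def)

lemma amul_inv [simp]: "g \<odot> ainv g = aone" "ainv g \<odot> g = aone"
  using r_nonzero by (simp_all add: amul_def ainv_def power_int_minus)

lemma amul_inv_cancel [simp]: "g \<odot> (ainv g \<odot> h) = h" "ainv g \<odot> (g \<odot> h) = h"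
  by (simp_all add: amul_assoc[symmetric])

lemma ainv_mul: "ainv (g \<odot> h) = ainv h \<odot> ainv g"
  by (metis amul_assoc amul_inv(2) amul_one amul_inv_cancel(1))

text \<open>\<open>assoc_sub True\<close> is generated by \<open>b\<close> and \<open>assoc_sub False\<close> by \<open>a\<^sup>k\<close>, where
  \<open>b = (1, 0)\<close> and \<open>a = (0, 1 / k)\<close>; the stable letter satisfies \<open>t b = a\<^sup>k t\<close>. Every \<open>g\<close> is uniquely
  a product of an element of \<open>assoc_sub e\<close> and a coset representative \<open>rep e g\<close>, and \<open>swap e g\<close>
  is the partner of the first factor in the other associated subgroup.\<close>

definition assoc_sub :: "bool \<Rightarrow> aff set" where
  "assoc_sub e = (if e then range (\<lambda>n. (n, 0)) else range (\<lambda>n. (0, of_int n)))"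

definition swap :: "bool \<Rightarrow> aff \<Rightarrow> aff" where
  "swap e g = (if e then (0, of_int (fst g)) else (\<lfloor>snd g\<rfloor>, 0))"

definition rep :: "bool \<Rightarrow> aff \<Rightarrow> aff" where
  "rep e g = (if e then (0, r powi (- fst g) * snd g) else (fst g, frac (snd g)))"

lemma assoc_sub_cases:
  assumes "c \<in> assoc_sub e"
  obtains n where "e" "c = (n, 0)" | n where "\<not> e" "c = (0, of_int n)"
  using assms by (auto simp: assoc_sub_def split: if_splits)

lemma swap_rep: "g = swap (\<not> e) (swap e g) \<odot> rep e g"
  using r_nonzero by (cases g) (simp add: swap_def rep_def amul_def frac_def power_int_minus)

lemma swap_in: "swap e g \<in> assoc_sub (\<not> e)"
  by (auto simp: swap_def assoc_sub_def)

lemma swap_swap: "c \<in> assoc_sub e \<Longrightarrow> swap (\<not> e) (swap e c) = c"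
  by (auto simp: swap_def assoc_sub_def split: if_splits)

lemma swap_mul: "c \<in> assoc_sub e \<Longrightarrow> swap e (c \<odot> g) = swap e c \<odot> swap e g"
  by (erule assoc_sub_cases) (auto simp: swap_def amul_def)

lemma rep_mul: "c \<in> assoc_sub e \<Longrightarrow> rep e (c \<odot> g) = rep e g"
  by (erule assoc_sub_cases)
     (auto simp: r_nonzero rep_def amul_def frac_def power_int_add power_int_minus power_int_diff field_simps)

lemma rep_rep: "rep e (rep e g) = rep e g" and swap_of_rep: "swap e (rep e g) = aone"
  by (auto simp: rep_def swap_def)

lemma rep_one_iff: "rep e g = aone \<longleftrightarrow> g \<in> assoc_sub e"
proof
  assume "rep e g = aone"
  then have "g = swap (\<not> e) (swap e g)" using swap_rep[of g e] by simp
  then show "g \<in> assoc_sub e" using swap_in[of "\<not> e" "swap e g"] by simp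
next
  assume "g \<in> assoc_sub e"
  then have "rep e (g \<odot> aone) = rep e aone" by (rule rep_mul)
  then show "rep e g = aone" by (simp add: rep_def)
qed

lemma assoc_sub_mul: "c \<in> assoc_sub e \<Longrightarrow> d \<in> assoc_sub e \<Longrightarrow> c \<odot> d \<in> assoc_sub e"
  by (metis rep_mul rep_one_iff)

lemma assoc_sub_inv: "c \<in> assoc_sub e \<Longrightarrow> ainv c \<in> assoc_sub e"
  by (metis rep_mul rep_one_iff amul_inv(1) amul_inv_cancel(2) amul_one(2))

section \<open>The class invariant\<close>

text \<open>Chosen so that taking n-th powers multiplies it by n, and so that the n-th powers of
  both b and a^k, the generators of the associated subgroups, have the value n.\<close>

definition scale :: "aff \<Rightarrow> rat" where
  "scale g = (if fst g = 0 then snd g else of_int (fst g))"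

definition scale_class :: "aff \<Rightarrow> rat set" where
  "scale_class g = range (\<lambda>j. scale g * r powi j)"

lemma range_scaled: "range (\<lambda>j::int. x * r powi i * r powi j) = range (\<lambda>j. x * r powi j)"
proof (intro equalityI image_subsetI)
  fix j
  show "x * r powi i * r powi j \<in> range (\<lambda>j. x * r powi j)"
    using r_nonzero by (intro image_eqI[of _ _ "i + j"]) (simp_all add: power_int_add)
  show "x * r powi j \<in> range (\<lambda>j. x * r powi i * r powi j)"
    using r_nonzero by (intro image_eqI[of _ _ "j - i"]) (simp_all add: power_int_diff)
qed

text \<open>Conjugation by \<open>h\<close> multiplies the rational component by r^(fst h) when the
  integer component is 0, and fixes a nonzero integer component.\<close>

lemma scale_class_conj: "scale_class (h \<odot> g \<odot> ainv h) = scale_class g"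
proof (cases "fst g = 0")
  case True
  then have "scale (h \<odot> g \<odot> ainv h) = scale g * r powi fst h"
    using r_nonzero by (simp add: scale_def amul_def ainv_def power_int_minus)
  then show ?thesis by (simp add: scale_class_def range_scaled)
next
  case False
  then show ?thesis by (simp add: scale_class_def scale_def amul_def ainv_def)
qed

lemma scale_class_swap: "c \<in> assoc_sub e \<Longrightarrow> scale_class (swap e c) = scale_class c"
  by (erule assoc_sub_cases) (auto simp: scale_class_def scale_def swap_def)

section \<open>Normal forms and the HNN extension\<close>

text \<open>The pair \<open>(g, [(e\<^sub>1, q\<^sub>1), \<dots>, (e\<^sub>n, q\<^sub>n)])\<close> stands for the normal form
  \<open>g t\<^bsup>e\<^sub>1\<^esup> q\<^sub>1 \<dots> t\<^bsup>e\<^sub>n\<^esup> q\<^sub>n\<close>, \<open>True\<close> encoding the exponent \<open>1\<close> and \<open>False\<close> the exponent \<open>-1\<close>.\<close>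

definition normal :: "syllable list \<Rightarrow> bool" where
  "normal s \<longleftrightarrow> (\<forall>(e, q) \<in> set s. rep e q = q) \<and>
     successively (\<lambda>(e, q) (e', q'). \<not> (e' = (\<not> e) \<and> q = aone)) s"

text \<open>Factor the base part as c q with c in \<open>assoc_sub e\<close> and q its coset
  representative; then t^e c q = c' t^e q, where c' is the partner of c.\<close>

definition push :: "bool \<Rightarrow> aff \<times> syllable list \<Rightarrow> aff \<times> syllable list" where
  "push e v = (swap e (fst v), (e, rep e (fst v)) # snd v)"

text \<open>Left multiplication of a normal form by t^e: a pinch t^e g t^-e is replaced by the
  partner of g, and otherwise a new syllable appears.\<close>

definition shift :: "bool \<Rightarrow> aff \<times> syllable list \<Rightarrow> aff \<times> syllable list" where
  "shift e v =
     (if fst v \<in> assoc_sub e \<and> snd v \<noteq> [] \<and> fst (hd (snd v)) = (\<not> e)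
      then (swap e (fst v) \<odot> snd (hd (snd v)), tl (snd v)) else push e v)"

lemma normal_Nil [simp]: "normal []"
  by (simp add: normal_def)

lemma normal_shift: "normal (snd v) \<Longrightarrow> normal (snd (shift e v))"
  by (cases v; cases "snd v")
     (auto simp: shift_def push_def normal_def successively_Cons rep_rep rep_one_iff)

lemma shift_shift:
  assumes "normal (snd v)"
  shows "shift (\<not> e) (shift e v) = v"
proof (cases "fst v \<in> assoc_sub e \<and> snd v \<noteq> [] \<and> fst (hd (snd v)) = (\<not> e)")
  case True
  obtain g q s where v: "v = (g, (\<not> e, q) # s)"
    using True by (cases v; cases "snd v") auto
  have g: "g \<in> assoc_sub e" using True v by simp
  have q: "rep (\<not> e) q = q" using assms by (auto simp: v normal_def)
  have sw: "swap (\<not> e) (swap e g \<odot> q) = g"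
    using swap_mul[OF swap_in, of e g q] swap_of_rep[of "\<not> e" q] g by (simp add: q swap_swap)
  have rp: "rep (\<not> e) (swap e g \<odot> q) = q"
    using rep_mul[OF swap_in, of e g q] by (simp add: q)
  \<comment> \<open>After a cancellation the opposite letter cannot cancel again: otherwise
    \<open>q\<close> would be trivial between opposite letters, which normality excludes.\<close>
  have *: "\<not> (swap e g \<odot> q \<in> assoc_sub (\<not> e) \<and> s \<noteq> [] \<and> fst (hd s) = e)"
  proof
    assume *: "swap e g \<odot> q \<in> assoc_sub (\<not> e) \<and> s \<noteq> [] \<and> fst (hd s) = e"
    then have "q = aone" using rp rep_one_iff by metis
    then show False using assms * by (cases s) (auto simp: v normal_def)
  qed
  then have "shift (\<not> e) (swap e g \<odot> q, s) = (g, (\<not> e, q) # s)"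
    by (auto simp: shift_def push_def sw rp)
  then show ?thesis using g by (simp add: v shift_def)
next
  case False
  then have "shift e v = push e v" by (auto simp: shift_def)
  then show ?thesis
    using swap_in[of e "fst v"] swap_rep[of "fst v" e] by (simp add: shift_def push_def)
qed

text \<open>Pairs that are not normal are fixed, so that a bijection of the whole type
  results.\<close>

definition left_mult :: "aff \<Rightarrow> (aff \<times> syllable list) perm" where
  "left_mult h = Perm (\<lambda>v. if normal (snd v) then (h \<odot> fst v, snd v) else v)"

definition stable :: "bool \<Rightarrow> (aff \<times> syllable list) perm" where
  "stable e = Perm (\<lambda>v. if normal (snd v) then shift e v else v)"

lemma papp_left_mult: "papp (left_mult h) v = (if normal (snd v) then (h \<odot> fst v, snd v) else v)"
proof -
  have "bij (\<lambda>v. if normal (snd v) then (h \<odot> fst v, snd v) else v)"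
    by (rule o_bij[where g = "\<lambda>v. if normal (snd v) then (ainv h \<odot> fst v, snd v) else v"]) auto
  then show ?thesis by (simp add: left_mult_def papp_Perm)
qed

lemma papp_stable: "papp (stable e) v = (if normal (snd v) then shift e v else v)"
proof -
  have "bij (\<lambda>v. if normal (snd v) then shift e v else v)"
    by (rule o_bij[where g = "\<lambda>v. if normal (snd v) then shift (\<not> e) v else v"])
       (use shift_shift[of _ e] shift_shift[of _ "\<not> e"] in \<open>auto simp: normal_shift\<close>)
  then show ?thesis by (simp add: stable_def papp_Perm)
qed

lemma left_mult_mul: "left_mult (g \<odot> h) = left_mult g + left_mult h"
  by (rule perm_eqI) (simp add: papp_left_mult amul_assoc)

lemma left_mult_one: "left_mult aone = 0"
  by (rule perm_eqI) (simp add: papp_left_mult)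

lemma left_mult_inv: "left_mult (ainv g) = - left_mult g"
  by (rule minus_unique[symmetric]) (simp add: left_mult_mul[symmetric] left_mult_one)

lemma stable_neg: "stable (\<not> e) = - stable e"
  by (rule minus_unique[symmetric], rule perm_eqI)
     (use shift_shift[of _ "\<not> e"] in \<open>auto simp: papp_stable normal_shift\<close>)

text \<open>The defining relation of the HNN extension. Multiplying the base part by
  \<open>c\<close> does not change which case of \<open>shift\<close> applies.\<close>

lemma stable_left_mult:
  assumes "c \<in> assoc_sub e"
  shows "stable e + left_mult c = left_mult (swap e c) + stable e"
proof (rule perm_eqI)
  fix v :: "aff \<times> syllable list"
  have "c \<odot> fst v \<in> assoc_sub e \<longleftrightarrow> fst v \<in> assoc_sub e"
    using assms assoc_sub_mul assoc_sub_inv[OF assms] amul_inv_cancel(2)[of c "fst v"] by metis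
  then have "shift e (c \<odot> fst v, snd v) = (swap e c \<odot> fst (shift e v), snd (shift e v))"
    by (simp add: shift_def push_def swap_mul[OF assms] rep_mul[OF assms] amul_assoc)
  then show "papp (stable e + left_mult c) v = papp (left_mult (swap e c) + stable e) v"
    by (cases "normal (snd v)") (simp_all add: papp_stable papp_left_mult normal_shift)
qed

text \<open>The same lists now stand for arbitrary products: the base factors need not be coset
  representatives.\<close>

definition syllables :: "syllable list \<Rightarrow> (aff \<times> syllable list) perm" where
  "syllables xs = sum_list (map (\<lambda>(e, h). stable e + left_mult h) xs)"

lemma syllables_Nil [simp]: "syllables [] = 0"
  and syllables_Cons: "syllables ((e, h) # xs) = stable e + left_mult h + syllables xs"
  and syllables_append: "syllables (xs @ ys) = syllables xs + syllables ys"
  by (simp_all add: syllables_def)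

text \<open>Excludes pinches t^e h t^-e with \<open>h\<close> in \<open>assoc_sub e\<close>.\<close>

definition reduced :: "syllable list \<Rightarrow> bool" where
  "reduced = successively (\<lambda>(e, h) (e', h'). \<not> (e' = (\<not> e) \<and> h \<in> assoc_sub e))"

end

section \<open>A growth estimate and repeated lists\<close>

text \<open>The difference P^j - Q^j is at least 2^j - 1, which outgrows every linear function of
  j.\<close>

lemma power_gap_superlinear:
  fixes P Q n c :: nat
  assumes "Q < P" "0 < Q" "0 < n"
  shows "\<exists>j. Q ^ j * n + j * c < P ^ j * n"
proof -
  have gap: "Q ^ j + 2 ^ j \<le> P ^ j + 1" for j
  proof (induction j)
    case (Suc j)
    have "2 ^ j \<le> P ^ j" using assms by (intro power_mono) auto
    moreover have "Q * (Q ^ j + 2 ^ j) \<le> Q * (P ^ j + 1)" using Suc by (rule mult_le_mono2)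
    moreover have "Q * P ^ j + P ^ j \<le> P * P ^ j"
      using mult_le_mono1[of "Q + 1" P "P ^ j"] assms by (simp add: algebra_simps)
    moreover have "2 ^ j + Q \<le> Q * 2 ^ j + 1"
    proof -
      have "Q * (2 ^ j - 1) \<ge> 1 * (2 ^ j - 1)" using assms by (intro mult_le_mono1) simp
      moreover have "Q * 1 \<le> Q * 2 ^ j" by (intro mult_le_mono2) simp
      ultimately show ?thesis unfolding diff_mult_distrib2 by linarith
    qed
    ultimately show ?case by (simp add: algebra_simps)
  qed simp
  have sq: "j * j < 2 ^ j" if "5 \<le> j" for j :: nat
    using that
  proof (induction j rule: dec_induct)
    case (step j)
    have "5 * j \<le> j * j" using step(1) by (rule mult_le_mono1)
    then have "2 * j + 1 \<le> j * j" using step(1) by linarith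
    then show ?case using step(3) by simp
  qed simp
  \<comment> \<open>For this j the square of j exceeds j c, and j is at least 5, so that 2^j exceeds
    the square.\<close>
  define j where "j = c + 5"
  have "j * c + 1 \<le> j * j" unfolding j_def by (simp add: algebra_simps)
  also have "\<dots> < 2 ^ j" by (rule sq) (simp add: j_def)
  finally have "Q ^ j + j * c < P ^ j" using gap[of j] by linarith
  then have "(Q ^ j + j * c) * n < P ^ j * n" using assms by simp
  moreover have "j * c * 1 \<le> j * c * n" using assms by (intro mult_le_mono2) simp
  ultimately have "Q ^ j * n + j * c < P ^ j * n" unfolding add_mult_distrib by linarith
  then show ?thesis by blast
qed

text \<open>Neighbours in a repeated list lie inside one copy or across one seam, and
  \<open>xs @ xs\<close> shows both kinds.\<close>

lemma successively_concat_replicate: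
  assumes "successively P (xs @ xs)"
  shows "successively P (concat (replicate n xs))"
proof (induction n)
  case (Suc n)
  then show ?case
    using assms by (cases n; cases "xs = []") (auto simp: successively_append_iff)
qed simp

lemma successively_cyclic:
  assumes "successively P (y # zs)" "successively P (zs @ [y])" "zs \<noteq> []"
  shows "successively P ((y # zs) @ (y # zs))"
  using assms by (auto simp: successively_append_iff successively_Cons)

context hnn_affine
begin

section \<open>Britton's lemma\<close>

text \<open>When a reduced product acts on a pair without syllables, no stable letter ever cancels;
  each one adds a syllable. This is the content of Britton's lemma.\<close>

lemma reduced_push:
  assumes "reduced ((e, h) # xs)" "v = papp (syllables xs) (u, [])"
  shows "papp (syllables ((e, h) # xs)) (u, []) = push e (h \<odot> fst v, snd v) \<and>
    normal (snd v) \<and> length (snd v) = length xs"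
  using assms
proof (induction xs arbitrary: e h v)
  case Nil
  then show ?case by (simp add: syllables_Cons papp_left_mult papp_stable shift_def)
next
  case (Cons y xs)
  obtain e' h' where y: "y = (e', h')" by (rule that[OF surjective_pairing])
  define w where "w = papp (syllables xs) (u, [])"
  have red: "reduced ((e', h') # xs)" and no: "\<not> (e' = (\<not> e) \<and> h \<in> assoc_sub e)"
    using Cons.prems(1) by (auto simp: y reduced_def)
  have v: "v = push e' (h' \<odot> fst w, snd w)" and w: "normal (snd w)" "length (snd w) = length xs"
    using Cons.IH[OF red w_def] by (simp_all add: Cons.prems(2) y)
  have "v = shift e' (h' \<odot> fst w, snd w)"
    using w(1) unfolding Cons.prems(2) w_def by (simp add: y syllables_Cons papp_left_mult papp_stable)
  then have nv: "normal (snd v)" using w(1) by (simp add: normal_shift)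
  \<comment> \<open>The preceding push left its base part in \<open>assoc_sub e\<close>, so a
    cancellation would require \<open>h\<close> itself to lie there.\<close>
  have "h \<odot> fst v \<in> assoc_sub e \<longleftrightarrow> h \<in> assoc_sub e" if "e' = (\<not> e)"
  proof -
    have f: "fst v \<in> assoc_sub e"
      using swap_in[of e' "h' \<odot> fst w"] that by (simp add: v push_def)
    have "h = h \<odot> fst v \<odot> ainv (fst v)" by (simp add: amul_assoc)
    then show ?thesis using assoc_sub_mul[OF _ f] assoc_sub_mul[OF _ assoc_sub_inv[OF f]] by metis
  qed
  moreover have "fst (hd (snd v)) = e'" by (simp add: v push_def)
  ultimately have "\<not> (h \<odot> fst v \<in> assoc_sub e \<and> snd v \<noteq> [] \<and> fst (hd (snd v)) = (\<not> e))"
    using no by blast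
  then have "shift e (h \<odot> fst v, snd v) = push e (h \<odot> fst v, snd v)"
    by (auto simp: shift_def)
  moreover have "papp (syllables ((e, h) # y # xs)) (u, []) = shift e (h \<odot> fst v, snd v)"
    using nv unfolding syllables_Cons[of e h] papp_plus Cons.prems(2)[symmetric]
    by (simp add: papp_left_mult papp_stable)
  ultimately show ?case using nv w(2) by (simp add: v push_def)
qed

lemma reduced_length:
  assumes "reduced xs"
  shows "length (snd (papp (syllables xs) (u, []))) = length xs"
proof (cases xs)
  case (Cons y ys)
  then show ?thesis using reduced_push[OF _ HOL.refl, of "fst y" "snd y" ys u] assms by (simp add: push_def)
qed simp

lemma reduced_tl: "reduced (y # xs) \<Longrightarrow> reduced xs"
  by (cases xs) (auto simp: reduced_def)

text \<open>Two starting points are followed through the same product. At each syllable the quotient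
  of the base parts is conjugated by \<open>h\<close> and then swapped into the other associated
  subgroup, and both operations preserve its scale class.\<close>

lemma scale_class_reduced:
  assumes "reduced xs"
    and "snd (papp (syllables xs) (u, [])) = snd (papp (syllables xs) (u', []))"
  shows "scale_class (fst (papp (syllables xs) (u, [])) \<odot> ainv (fst (papp (syllables xs) (u', []))))
       = scale_class (u \<odot> ainv u')"
  using assms
proof (induction xs)
  case (Cons y xs)
  obtain e h where y: "y = (e, h)" by (rule that[OF surjective_pairing])
  define v v' where "v = papp (syllables xs) (u, [])" and "v' = papp (syllables xs) (u', [])"
  have push: "papp (syllables (y # xs)) (u, []) = push e (h \<odot> fst v, snd v)"
    "papp (syllables (y # xs)) (u', []) = push e (h \<odot> fst v', snd v')"
    using reduced_push[OF Cons.prems(1)[unfolded y] HOL.refl] unfolding y v_def v'_def by blast+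
  define g g' where "g = h \<odot> fst v" and "g' = h \<odot> fst v'"
  define c c' where "c = swap (\<not> e) (swap e g)" and "c' = swap (\<not> e) (swap e g')"
  have snd: "snd v = snd v'" and rep: "rep e g = rep e g'"
    using Cons.prems(2) unfolding push by (auto simp: push_def g_def g'_def)
  have cin: "c \<in> assoc_sub e" "c' \<in> assoc_sub e"
    using swap_in[of "\<not> e"] by (simp_all add: c_def c'_def)
  have sw: "swap e g = swap e c" "swap e g' = swap e c'"
    using swap_swap[OF swap_in, of e] by (simp_all add: c_def c'_def)
  \<comment> \<open>Equal syllables mean equal coset representatives, which cancel in the
    quotient.\<close>
  have quot: "c \<odot> ainv c' = g \<odot> ainv g'"
    using swap_rep[of g e] swap_rep[of g' e] rep unfolding c_def[symmetric] c'_def[symmetric]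
    by (metis amul_assoc ainv_mul amul_inv_cancel(1))
  have "swap e c \<odot> ainv (swap e c') = swap e (c \<odot> ainv c')"
  proof -
    have "swap e c = swap e (c \<odot> ainv c') \<odot> swap e c'"
      using swap_mul[OF assoc_sub_mul[OF cin(1) assoc_sub_inv[OF cin(2)]], of c']
      by (simp add: amul_assoc)
    then show ?thesis by (simp add: amul_assoc)
  qed
  then have "scale_class (swap e g \<odot> ainv (swap e g')) = scale_class (g \<odot> ainv g')"
    using scale_class_swap[OF assoc_sub_mul[OF cin(1) assoc_sub_inv[OF cin(2)]]]
    by (simp add: sw quot)
  also have "g \<odot> ainv g' = h \<odot> (fst v \<odot> ainv (fst v')) \<odot> ainv h"
    by (simp add: g_def g'_def ainv_mul amul_assoc)
  also have "scale_class \<dots> = scale_class (u \<odot> ainv u')"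
    using Cons.IH reduced_tl[OF Cons.prems(1)] snd
    unfolding scale_class_conj v_def v'_def by blast
  finally show ?case unfolding push by (simp add: push_def g_def g'_def)
qed simp

section \<open>Syllable length\<close>

text \<open>Products with exactly \<open>n\<close> stable letters, reduced or not; hence
  \<open>n\<close> is only an upper bound for the normal form length.\<close>

definition reach :: "nat \<Rightarrow> (aff \<times> syllable list) perm set" where
  "reach n = {left_mult h + syllables xs | h xs. length xs = n}"

definition hnn :: "(aff \<times> syllable list) perm set" where
  "hnn = (\<Union>n. reach n)"

lemma hnnI: "p \<in> reach n \<Longrightarrow> p \<in> hnn"
  by (auto simp: hnn_def)

lemma hnnE: "p \<in> hnn \<Longrightarrow> (\<And>n. p \<in> reach n \<Longrightarrow> thesis) \<Longrightarrow> thesis"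
  by (auto simp: hnn_def)

lemma reachI: "length xs = n \<Longrightarrow> left_mult h + syllables xs \<in> reach n"
  unfolding reach_def by blast

lemma left_mult_reach: "left_mult h \<in> reach 0"
  using reachI[of "[]" 0 h] by simp

lemma zero_reach: "0 \<in> reach 0"
  using left_mult_reach[of aone] by (simp add: left_mult_one)

lemma syllables_reach: "syllables xs \<in> reach (length xs)"
  using reachI[of xs _ aone] by (simp add: left_mult_one)

lemma stable_reach: "stable e \<in> reach 1"
  using syllables_reach[of "[(e, aone)]"] by (simp add: syllables_Cons left_mult_one)

lemma syllables_absorb:
  assumes "xs \<noteq> []"
  shows "\<exists>ys. length ys = length xs \<and> syllables xs + left_mult k = syllables ys"
proof -
  obtain us e h where "xs = us @ [(e, h)]"
    using assms by (metis rev_exhaust surj_pair)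
  then show ?thesis
    by (intro exI[of _ "us @ [(e, h \<odot> k)]"])
       (simp add: syllables_append syllables_Cons left_mult_mul add.assoc)
qed

lemma reach_add:
  assumes "p \<in> reach m" "q \<in> reach n"
  shows "p + q \<in> reach (m + n)"
proof -
  obtain h xs where p: "p = left_mult h + syllables xs" "length xs = m"
    using assms by (auto simp: reach_def)
  obtain k ys where q: "q = left_mult k + syllables ys" "length ys = n"
    using assms by (auto simp: reach_def)
  show ?thesis
  proof (cases "xs = []")
    case True
    then have "p + q = left_mult (h \<odot> k) + syllables ys" "m = 0"
      using p q by (simp_all add: left_mult_mul add.assoc)
    then show ?thesis using q by (simp add: reachI)
  next
    case False
    then obtain zs where zs: "length zs = m" "syllables xs + left_mult k = syllables zs"
      using syllables_absorb p by blast
    have "p + q = left_mult h + (syllables xs + left_mult k) + syllables ys"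
      by (simp add: p q add.assoc)
    then have "p + q = left_mult h + syllables (zs @ ys)"
      by (simp add: zs(2) syllables_append add.assoc)
    then show ?thesis using zs q by (simp add: reachI)
  qed
qed

lemma reach_uminus:
  assumes "p \<in> reach n"
  shows "- p \<in> reach n"
proof -
  have *: "- syllables xs \<in> reach (length xs)" for xs
  proof (induction xs)
    case Nil
    then show ?case using zero_reach by simp
  next
    case (Cons y xs)
    obtain e h where y: "y = (e, h)" by (rule that[OF surjective_pairing])
    have "- syllables (y # xs) = - syllables xs + (left_mult (ainv h) + stable (\<not> e))"
      by (simp only: y syllables_Cons left_mult_inv stable_neg minus_add add.assoc)
    moreover have "left_mult (ainv h) + stable (\<not> e) \<in> reach 1"
      using reach_add[OF left_mult_reach stable_reach] by simp
    ultimately show ?case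
      using reach_add[OF Cons, of "left_mult (ainv h) + stable (\<not> e)" 1] by simp
  qed
  obtain h xs where p: "p = left_mult h + syllables xs" "length xs = n"
    using assms by (auto simp: reach_def)
  then have "- p = - syllables xs + left_mult (ainv h)"
    by (simp only: minus_add left_mult_inv)
  then show ?thesis using reach_add[OF * left_mult_reach] p(2) by fastforce
qed

lemma hnn_add: "p \<in> hnn \<Longrightarrow> q \<in> hnn \<Longrightarrow> p + q \<in> hnn"
  and hnn_uminus: "p \<in> hnn \<Longrightarrow> - p \<in> hnn"
  by (meson hnnI hnnE reach_add reach_uminus)+

text \<open>A pinch equals a base element, so replacing it removes two stable letters.\<close>

lemma not_reduced_shorten:
  assumes "\<not> reduced xs"
  shows "\<exists>n < length xs. syllables xs \<in> reach n"
  using assms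
proof (induction xs)
  case (Cons y xs)
  obtain e h where y: "y = (e, h)" by (rule that[OF surjective_pairing])
  show ?case
  proof (cases "reduced xs")
    case False
    then obtain n where n: "n < length xs" "syllables xs \<in> reach n" using Cons.IH by blast
    have "syllables (y # xs) = syllables [y] + syllables xs"
      by (simp add: y syllables_Cons)
    then have "syllables (y # xs) \<in> reach (1 + n)"
      using reach_add[OF syllables_reach[of "[y]"] n(2)] by simp
    then show ?thesis using n(1) by (intro exI[of _ "1 + n"]) simp
  next
    case True
    have "xs \<noteq> []" using Cons.prems by (auto simp: reduced_def)
    then obtain e' h' zs where xs': "xs = (e', h') # zs" by (metis neq_Nil_conv surj_pair)
    then have "e' = (\<not> e)" and h: "h \<in> assoc_sub e"
      using Cons.prems True by (simp_all add: reduced_def y)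
    with xs' have xs: "xs = (\<not> e, h') # zs" by simp
    have "syllables (y # xs) = (stable e + left_mult h) + (- stable e + (left_mult h' + syllables zs))"
      by (simp only: y xs syllables_Cons stable_neg add.assoc)
    also have "\<dots> = left_mult (swap e h \<odot> h') + syllables zs"
      by (simp only: stable_left_mult[OF h] left_mult_mul add.assoc add_minus_cancel)
    finally show ?thesis by (intro exI[of _ "length zs"]) (simp add: reachI xs)
  qed
qed (simp add: reduced_def)

lemma hnn_reduced:
  assumes "p \<in> hnn"
  shows "\<exists>h xs. reduced xs \<and> p = left_mult h + syllables xs"
proof -
  obtain n where "p \<in> reach n" using assms by (rule hnnE)
  then show ?thesis
  proof (induction n rule: less_induct)
    case (less n)
    obtain h xs where p: "p = left_mult h + syllables xs" "length xs = n"
      using less.prems by (auto simp: reach_def)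
    show ?case
    proof (cases "reduced xs")
      case False
      then obtain m where "m < n" "syllables xs \<in> reach m"
        using not_reduced_shorten p(2) by blast
      moreover have "p \<in> reach (0 + m)"
        unfolding p(1) using \<open>syllables xs \<in> reach m\<close> by (rule reach_add[OF left_mult_reach])
      ultimately show ?thesis using less.IH by simp
    qed (use p in blast)
  qed
qed

text \<open>Each stable letter adds or removes at most one syllable.\<close>

lemma reach_length:
  assumes "p \<in> reach n" "normal (snd v)"
  shows "length (snd (papp p v)) \<le> n + length (snd v)"
proof -
  have *: "normal (snd (papp (syllables xs) v)) \<and>
      length (snd (papp (syllables xs) v)) \<le> length xs + length (snd v)" for xs
  proof (induction xs)
    case (Cons y xs)
    have "length (snd (shift e w)) \<le> Suc (length (snd w))" for e w
      by (auto simp: shift_def push_def)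
    from this[of "fst y" "(snd y \<odot> fst (papp (syllables xs) v), snd (papp (syllables xs) v))"]
    show ?case using Cons
      by (cases y) (auto simp: syllables_Cons papp_left_mult papp_stable normal_shift)
  qed (simp add: assms(2))
  then show ?thesis using assms(1) by (auto simp: reach_def papp_left_mult)
qed

section \<open>Conjugacy in the HNN extension\<close>

text \<open>After the base factor of \<open>q\<close> is moved into \<open>w\<close>, both sides act
  on the trivial normal form. The starting points \<open>u\<close> and \<open>aone\<close> then lead
  to the same syllables, and their base parts differ by the modified \<open>w\<close>.\<close>

lemma scale_class_hnn_conj:
  assumes "q \<in> hnn" "q + left_mult u = left_mult w + q"
  shows "scale_class u = scale_class w"
proof -
  obtain h xs where red: "reduced xs" and q: "q = left_mult h + syllables xs"
    using hnn_reduced[OF assms(1)] by blast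
  define w' where "w' = ainv h \<odot> w \<odot> ainv (ainv h)"
  have hh: "ainv (ainv h) = h" by (metis amul_inv(2) amul_inv_cancel(1) amul_one(2))
  have "syllables xs + left_mult u = - left_mult h + (q + left_mult u)"
    by (simp add: q add.assoc)
  also have "\<dots> = left_mult w' + syllables xs"
    unfolding assms(2) by (simp only: q w'_def hh left_mult_mul left_mult_inv add.assoc)
  finally have eq: "papp (syllables xs + left_mult u) (aone, [])
      = papp (left_mult w' + syllables xs) (aone, [])" by simp
  let ?v = "papp (syllables xs) (aone, [])"
  have "normal (snd ?v)"
  proof (cases xs)
    case (Cons y ys)
    then show ?thesis
      using reduced_push[OF _ HOL.refl, of "fst y" "snd y" ys aone] red
      by (cases y) (simp add: syllables_Cons papp_left_mult papp_stable normal_shift)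
  qed simp
  then have uv: "papp (syllables xs) (u, []) = (w' \<odot> fst ?v, snd ?v)"
    using eq by (simp add: papp_left_mult)
  have "scale_class (w' \<odot> fst ?v \<odot> ainv (fst ?v)) = scale_class (u \<odot> ainv aone)"
    using scale_class_reduced[OF red, of u aone] by (simp add: uv)
  moreover have "ainv aone = aone" by (simp add: ainv_def)
  ultimately have "scale_class w' = scale_class u" by (simp add: amul_assoc)
  then show ?thesis by (simp add: w'_def scale_class_conj)
qed

text \<open>Take a conjugate with the fewest stable letters. If there are any, minimality makes the
  product and its rotation reduced, so the seam in \<open>xs @ xs\<close> contains no pinch.\<close>

lemma cyclic_reduction:
  assumes "x \<in> hnn"
  obtains w u where "w \<in> hnn" "- w + x + w = left_mult u"
  | w xs where "w \<in> hnn" "- w + x + w = syllables xs" "xs \<noteq> []" "reduced (xs @ xs)"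
proof -
  define conj where "conj n \<longleftrightarrow> (\<exists>w \<in> hnn. - w + x + w \<in> reach n)" for n
  have zero: "0 \<in> hnn" using zero_reach by (rule hnnI)
  obtain m where "x \<in> reach m" using assms by (rule hnnE)
  then have "conj m" unfolding conj_def by (intro bexI[OF _ zero]) simp
  then obtain n where n: "conj n" and min: "\<And>m. m < n \<Longrightarrow> \<not> conj m"
    using exists_least_iff[of conj] \<open>conj m\<close> by blast
  have conj_step: "conj m" if "w \<in> hnn" "w' \<in> hnn" "- w + x + w = y" "- w' + y + w' \<in> reach m" for w w' y m
  proof -
    have "- (w + w') + x + (w + w') = - w' + (- w + x + w) + w'" by (simp only: group_simps)
    then show ?thesis using that hnn_add[OF that(1,2)] unfolding conj_def by metis
  qed
  obtain w where w_in: "w \<in> hnn" "- w + x + w \<in> reach n"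
    using n unfolding conj_def by blast
  then obtain h xs where "- w + x + w = left_mult h + syllables xs" "length xs = n"
    unfolding reach_def by blast
  note w = w_in(1) this
  show ?thesis
  proof (cases "xs = []")
    case True
    then show ?thesis using w that(1) by simp
  next
    case False
    then obtain ys where ys: "length ys = n" "syllables xs + left_mult h = syllables ys"
      using syllables_absorb w(3) by blast
    \<comment> \<open>Conjugation moves the leading base factor to the end, where the last syllable
      absorbs it.\<close>
    define w' where "w' = w + left_mult h"
    have w'_in: "w' \<in> hnn" unfolding w'_def by (rule hnn_add[OF w(1) hnnI[OF left_mult_reach]])
    have "- w' + x + w' = - left_mult h + (- w + x + w) + left_mult h"
      unfolding w'_def by (simp only: group_simps)
    then have w': "- w' + x + w' = syllables ys"
      unfolding w(2) ys(2)[symmetric] by (simp only: group_simps)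
    have red: "reduced ys"
    proof (rule ccontr)
      assume "\<not> reduced ys"
      then obtain m where "m < n" "syllables ys \<in> reach m"
        using not_reduced_shorten ys(1) by blast
      then show False using min w' w'_in by (metis conj_def)
    qed
    have "ys \<noteq> []" using False ys w(3) by auto
    then obtain e k zs where y: "ys = (e, k) # zs" by (metis neq_Nil_conv surj_pair)
    have "reduced (ys @ ys)"
    proof (cases "zs = []")
      case True
      then show ?thesis by (simp add: y reduced_def)
    next
      case ne: False
      have rot: "reduced (zs @ [(e, k)])"
      proof (rule ccontr)
        assume "\<not> reduced (zs @ [(e, k)])"
        then obtain m where m: "m < length (zs @ [(e, k)])" "syllables (zs @ [(e, k)]) \<in> reach m"
          using not_reduced_shorten by blast
        then have "m < n" using ys(1) y by simp
        \<comment> \<open>Conjugation by the first syllable rotates the product.\<close>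
        have "- syllables [(e, k)] + syllables ys + syllables [(e, k)] = syllables (zs @ [(e, k)])"
          by (simp only: y syllables_append syllables_Cons syllables_Nil group_simps)
        moreover have "syllables [(e, k)] \<in> hnn" by (rule hnnI[OF syllables_reach])
        ultimately have "conj m" using conj_step[OF w'_in _ w'] m(2) by metis
        then show False using min \<open>m < n\<close> by blast
      qed
      show ?thesis using red rot ne
        unfolding reduced_def y by (intro successively_cyclic)
    qed
    then show ?thesis using that(2) w' w'_in \<open>ys \<noteq> []\<close> by blast
  qed
qed

text \<open>If \<open>x\<close> were not conjugate into the base, the length of \<open>x\<^sup>N\<close> would grow linearly in \<open>N\<close>;
  but \<open>z\<^sup>i\<close> conjugates \<open>x ^ (p ^ i)\<close> to \<open>x ^ (q ^ i)\<close> and changes lengths by a multiple of \<open>i\<close> only.\<close>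

lemma conj_into_base:
  assumes "x \<in> hnn" "z \<in> hnn" "- z + zpow x p + z = zpow x q" "\<bar>q\<bar> < \<bar>p\<bar>" "q \<noteq> 0"
  obtains w u where "w \<in> hnn" "- w + x + w = left_mult u"
proof -
  consider (base) w u where "w \<in> hnn" "- w + x + w = left_mult u"
    | (cyclic) w xs where "w \<in> hnn" "- w + x + w = syllables xs" "xs \<noteq> []" "reduced (xs @ xs)"
    using assms(1) by (rule cyclic_reduction)
  then show ?thesis
  proof cases
    case base
    then show ?thesis by (rule that)
  next
    case 2: (cyclic w xs)
    define y where "y = syllables xs"
    define g where "g = - w + z + w"
    have "g \<in> hnn" unfolding g_def by (intro hnn_add hnn_uminus 2 assms)
    then obtain c where c: "g \<in> reach c" by (rule hnnE)
    have "- g + zpow y p + g = - w + (- z + zpow x p + z) + w"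
      unfolding y_def 2(2)[symmetric] zpow_conj g_def by (simp only: group_simps)
    also have "\<dots> = zpow y q"
      unfolding assms(3) y_def 2(2)[symmetric] zpow_conj ..
    finally have rel: "- g + zpow y p + g = zpow y q" .
    have g_reach: "zpow g (int i) \<in> reach (i * c)" for i
    proof (induction i)
      case 0
      then show ?case using zero_reach by simp
    next
      case (Suc i)
      have "zpow g (int (Suc i)) = g + zpow g (int i)"
        using zpow_Suc[of g "int i"] by (simp add: add.commute)
      then show ?case using reach_add[OF c Suc] by simp
    qed
    have power: "zpow y (int N) = syllables (concat (replicate N xs))" for N
      by (simp add: y_def syllables_def map_concat zpow_replicate)
    have y_length: "length (snd (papp (zpow y (int N)) (aone, []))) = N * length xs" for N
    proof -
      have "reduced (concat (replicate N xs))"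
        using 2(4) unfolding reduced_def by (rule successively_concat_replicate)
      then show ?thesis by (simp add: power reduced_length length_concat sum_list_replicate)
    qed
    \<comment> \<open>Passing to squares removes the signs of p and q. The exponent i = 2 j then
      costs i c on each side of the conjugation, which accounts for the constant 4 c.\<close>
    define P Q where "P = nat (p\<^sup>2)" and "Q = nat (q\<^sup>2)"
    have PQ: "int P = p\<^sup>2" "int Q = q\<^sup>2" by (simp_all add: P_def Q_def)
    have "q\<^sup>2 < p\<^sup>2" using assms(4) abs_le_square_iff[of p q] by linarith
    then have "Q < P" using PQ by linarith
    moreover have "0 < Q" using assms(5) by (simp add: Q_def)
    ultimately obtain j where j: "Q ^ j * length xs + j * (4 * c) < P ^ j * length xs"
      using power_gap_superlinear[of Q P "length xs" "4 * c"] 2(3) by auto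
    define i where "i = 2 * j"
    have pq: "p ^ i = int (P ^ j)" "q ^ i = int (Q ^ j)"
      by (simp_all add: i_def power_mult PQ)
    have "zpow y (int (P ^ j)) = zpow g (int i) + zpow y (int (Q ^ j)) + - zpow g (int i)"
      using zpow_conj_iterate[OF rel, of i, symmetric] unfolding pq by (simp only: group_simps)
    moreover have "zpow y (int (Q ^ j)) \<in> reach (Q ^ j * length xs)"
      unfolding power using syllables_reach[of "concat (replicate (Q ^ j) xs)"]
      by (simp add: length_concat sum_list_replicate)
    ultimately have "zpow y (int (P ^ j)) \<in> reach (i * c + Q ^ j * length xs + i * c)"
      using reach_add[OF reach_add[OF g_reach] reach_uminus[OF g_reach]] by metis
    from reach_length[OF this, of "(aone, [])"]
    have "P ^ j * length xs \<le> i * c + Q ^ j * length xs + i * c"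
      by (simp add: y_length del: of_nat_power)
    moreover have "i * c + i * c = j * (4 * c)" by (simp add: i_def)
    ultimately show ?thesis using j by linarith
  qed
qed

text \<open>Records just what \<open>scale\<close> reads: the integer component, and the rational
  one when the integer component of \<open>u\<close> is 0.\<close>

lemma zpow_left_mult:
  "\<exists>c. zpow (left_mult u) n = left_mult (n * fst u, c) \<and> (fst u = 0 \<longrightarrow> c = of_int n * snd u)"
proof (induction n rule: int_induct[where k = 0])
  case base
  show ?case by (auto simp: left_mult_one intro!: exI[of _ 0])
next
  case (step1 i)
  then obtain c where c: "zpow (left_mult u) i = left_mult (i * fst u, c)"
    "fst u = 0 \<longrightarrow> c = of_int i * snd u" by blast
  have "zpow (left_mult u) (i + 1) = left_mult (u \<odot> (i * fst u, c))"
    by (simp only: zpow_Suc c left_mult_mul)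
  then show ?case using c(2)
    by (intro exI[of _ "snd (u \<odot> (i * fst u, c))"]) (auto simp: amul_def algebra_simps)
next
  case (step2 i)
  then obtain c where c: "zpow (left_mult u) i = left_mult (i * fst u, c)"
    "fst u = 0 \<longrightarrow> c = of_int i * snd u" by blast
  have "zpow (left_mult u) (i - 1) = left_mult (ainv u \<odot> (i * fst u, c))"
    by (simp only: zpow_pred c left_mult_mul left_mult_inv)
  then show ?case using c(2)
    by (intro exI[of _ "snd (ainv u \<odot> (i * fst u, c))"]) (auto simp: amul_def ainv_def algebra_simps)
qed

text \<open>For a conjugate \<open>u\<close> of \<open>x\<close> in the base, p
  \<open>scale u\<close> and q \<open>scale u\<close> have the same class modulo powers of r, and
  \<open>scale u\<close> cancels because it vanishes only at the identity.\<close>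

lemma conj_power_ratio:
  assumes "x \<in> hnn" "z \<in> hnn" "x \<noteq> 0" "- z + zpow x p + z = zpow x q" "\<bar>q\<bar> < \<bar>p\<bar>" "q \<noteq> 0"
  shows "\<exists>j. of_int p = of_int q * r powi j"
proof -
  obtain w u where w: "w \<in> hnn" "- w + x + w = left_mult u"
    using assms(1,2,4-6) by (rule conj_into_base)
  have "scale u \<noteq> 0"
  proof
    assume "scale u = 0"
    then have "u = aone" by (cases u) (auto simp: scale_def split: if_splits)
    have "x = w + (- w + x + w) + - w" by (simp only: group_simps)
    also have "\<dots> = 0" unfolding w(2) \<open>u = aone\<close> left_mult_one by simp
    finally show False using assms(3) by blast
  qed
  have power: "\<exists>v. zpow (left_mult u) n = left_mult v \<and> scale v = of_int n * scale u" if "n \<noteq> 0" for n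
  proof -
    obtain c where "zpow (left_mult u) n = left_mult (n * fst u, c)"
      "fst u = 0 \<longrightarrow> c = of_int n * snd u"
      using zpow_left_mult by blast
    then show ?thesis using that by (intro exI[of _ "(n * fst u, c)"]) (simp add: scale_def)
  qed
  have "p \<noteq> 0" using assms(5) by auto
  obtain up where up: "zpow (left_mult u) p = left_mult up" "scale up = of_int p * scale u"
    using power[OF \<open>p \<noteq> 0\<close>] by blast
  obtain uq where uq: "zpow (left_mult u) q = left_mult uq" "scale uq = of_int q * scale u"
    using power[OF assms(6)] by blast
  define g where "g = - w + z + w"
  have "g \<in> hnn" unfolding g_def by (intro hnn_add hnn_uminus w assms)
  moreover have "g + left_mult uq = left_mult up + g"
    unfolding up(1)[symmetric] uq(1)[symmetric] w(2)[symmetric] zpow_conj g_def assms(4)[symmetric]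
    by (simp only: group_simps)
  ultimately have "scale_class uq = scale_class up" by (rule scale_class_hnn_conj)
  moreover have "scale up * r powi 0 \<in> scale_class up" unfolding scale_class_def by (rule rangeI)
  ultimately have "scale up \<in> scale_class uq" by simp
  then obtain j where "scale up = scale uq * r powi j" unfolding scale_class_def by (rule rangeE)
  then have "of_int p = of_int q * r powi j" using \<open>scale u \<noteq> 0\<close> by (simp add: up(2) uq(2))
  then show ?thesis ..
qed

end

section \<open>Epimorphisms and the ratio of exponents\<close>

text \<open>If a is sent to the identity, all values lie in the cyclic group generated by
  \<open>y\<close>.\<close>

lemma word_val_0_left: "word_val 0 y w = zpow y (word_val 0 1 w)"
proof (induction w)
  case (Cons z w)
  have "letter_val 0 y z = zpow y (letter_val 0 1 z)"
    by (cases "(y, y, z)" rule: letter_val.cases) (auto simp: zpow_minus[of _ 1, simplified])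
  then show ?case using Cons by (simp add: word_val_Cons zpow_add)
qed simp

text \<open>The first group is evaluated in the HNN extension for r = l1 / m1. The images
  \<open>x\<close>, \<open>y\<close> of the second pair of generators produce all values, so
  \<open>x\<close> is nontrivial because the values do not commute, and the second relation makes
  two powers of \<open>x\<close> conjugate.\<close>

lemma epi_exponent_ratio:
  assumes "homomorphic_image (G l1 m1 k1) (G l2 m2 k2)"
    and "l1 \<noteq> 0" "m1 \<noteq> 0" "k1 \<noteq> 0" "m2 \<noteq> 0" "\<bar>m2\<bar> < \<bar>l2\<bar>"
  shows "\<exists>j. of_int l2 = of_int m2 * (of_int l1 / of_int m1 :: rat) powi j"
proof -
  define r :: rat where "r = of_int l1 / of_int m1"
  interpret hnn_affine r by standard (use assms in \<open>simp add: r_def\<close>)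
  define a where "a = left_mult (0, 1 / of_int k1)"
  define t where "t = stable True"
  have a_pow: "zpow a n = left_mult (0, of_int n / of_int k1)" for n
    using zpow_left_mult[of "(0, 1 / of_int k1)" n] by (simp add: a_def)
  \<comment> \<open>The element (0, 1) is a^k1, and t^-1 carries it to b = (1, 0).\<close>
  have "- t + left_mult (0, 1) = left_mult (1, 0) + - t"
    using stable_left_mult[of "(0, 1)" False] stable_neg[of True]
    by (simp add: t_def swap_def assoc_sub_def image_iff)
  then have b: "- t + zpow a k1 + t = left_mult (1, 0)"
    using assms(4) by (simp add: a_pow add.assoc)
  have "- left_mult (1, 0) + zpow a l1 + left_mult (1, 0)
      = left_mult (amul (amul (ainv (1, 0)) (0, of_int l1 / of_int k1)) (1, 0))"
    by (simp only: a_pow left_mult_mul left_mult_inv)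
  moreover have "inverse r * (of_int l1 / of_int k1) = of_int m1 / of_int k1"
    using assms(2-4) by (simp add: r_def)
  then have "amul (amul (ainv (1, 0)) (0, of_int l1 / of_int k1)) (1, 0) = (0, of_int m1 / of_int k1)"
    by (simp add: amul_def ainv_def power_int_minus)
  ultimately have rel1: "word_val a t (relator l1 m1 k1) = 0"
    unfolding word_val_relator b by (simp add: a_pow)
  \<comment> \<open>On the trivial normal form, \<open>a + t\<close> puts 1 / k1 into the base part
    and \<open>t + a\<close> puts it into the syllable.\<close>
  have noncomm: "a + t \<noteq> t + a"
  proof
    assume "a + t = t + a"
    then have "papp (a + t) (aone, []) = papp (t + a) (aone, [])" by simp
    then show False using assms(4)
      by (simp add: a_def t_def papp_left_mult papp_stable normal_shift)
         (simp add: shift_def push_def amul_def rep_def)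
  qed
  have word_hnn: "word_val a t w \<in> hnn" for w
  proof (induction w)
    case Nil
    then show ?case using hnnI[OF zero_reach] by simp
  next
    case (Cons y w)
    have "a \<in> hnn" "t \<in> hnn" unfolding a_def t_def by (rule hnnI[OF left_mult_reach] hnnI[OF stable_reach])+
    then have "letter_val a t y \<in> hnn"
      using hnn_uminus by (cases "(a, t, y)" rule: letter_val.cases) auto
    then show ?case unfolding word_val_Cons using Cons by (rule hnn_add)
  qed
  obtain u v where rel: "\<And>s. s \<in> {relator l2 m2 k2} \<Longrightarrow> (word_subst u v s, []) \<in> word_eqv {relator l1 m1 k1}"
    and surj: "\<And>w. \<exists>w'. (w, word_subst u v w') \<in> word_eqv {relator l1 m1 k1}"
    using presented_epi_words assms(1) unfolding G_def by metis
  have val: "word_val a t w = word_val a t w'" if "(w, w') \<in> word_eqv {relator l1 m1 k1}" for w w'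
    using that by (rule word_val_eqv) (simp add: rel1)
  define x y where "x = word_val a t u" and "y = word_val a t v"
  have surj': "\<exists>w'. word_val a t w = word_val x y w'" for w
    using surj[of w] val unfolding x_def y_def word_val_subst[symmetric] by blast
  define z where "z = - y + zpow x k2 + y"
  have "word_val x y (relator l2 m2 k2) = 0"
    using val[OF rel[OF singletonI]] by (simp add: word_val_subst x_def y_def)
  then have conj: "- z + zpow x l2 + z = zpow x m2"
    unfolding word_val_relator z_def[symmetric] by (simp only: right_minus_eq)
  have "x \<noteq> 0"
  proof
    assume x: "x = 0"
    have "word_val x y w = zpow y (word_val 0 1 w)" for w
      unfolding x by (rule word_val_0_left)
    then have "\<exists>i. word_val a t w = zpow y i" for w
      using surj'[of w] by metis
    from this[of wa] this[of wt] obtain i j where "a = zpow y i" "t = zpow y j"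
      unfolding word_val_wa word_val_wt by blast
    then have "a + t = zpow y (i + j)" "t + a = zpow y (j + i)"
      by (simp_all only: zpow_add)
    then show False using noncomm by (simp add: add.commute)
  qed
  moreover have "x \<in> hnn" "z \<in> hnn"
  proof -
    show "x \<in> hnn" unfolding x_def by (rule word_hnn)
    have "z = word_val a t (inv_word v @ pow_word u k2 @ v)"
      by (simp add: z_def x_def y_def add.assoc)
    then show "z \<in> hnn" by (simp only: word_hnn)
  qed
  ultimately have "\<exists>j. of_int l2 = of_int m2 * r powi j"
    using conj_power_ratio[OF _ _ _ conj assms(6,5)] by blast
  then show ?thesis unfolding r_def .
qed

section \<open>Mutual powers and the conclusion\<close>

text \<open>Both exponents must be positive; an exponent i above 1 would give x < y, while a
  positive j gives y \<le> x.\<close>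

lemma powi_mutual_unit:
  fixes x y :: rat
  assumes "1 < x" "1 < y" "y = x powi i" "x = y powi j"
  shows "i = 1"
proof -
  have pos: "0 < i" if "1 < w" "1 < w powi i" for w :: rat and i
  proof (rule ccontr)
    assume "\<not> 0 < i"
    then have "w powi i \<le> w powi 0" using that(1) by (intro power_int_increasing) auto
    then show False using that(2) by simp
  qed
  have "0 < i" "0 < j"
    using pos[OF assms(1) assms(2)[unfolded assms(3)]] pos[OF assms(2) assms(1)[unfolded assms(4)]]
    by auto
  show ?thesis
  proof (rule ccontr)
    assume "i \<noteq> 1"
    then have "x powi 1 < y"
      unfolding assms(3) using \<open>0 < i\<close> assms(1) by (intro power_int_strict_increasing) auto
    moreover have "y powi 1 \<le> x"
      by (subst assms(4)) (use \<open>0 < j\<close> assms(2) in \<open>intro power_int_increasing; auto\<close>)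
    ultimately show False by simp
  qed
qed

theorem mainTheorem1:
  fixes l1 m1 k1 l2 m2 k2 :: int
  assumes "\<bar>l1\<bar> \<ge> m1" "m1 > 0" "k1 > 0"
      and "\<bar>l2\<bar> \<ge> m2" "m2 > 0" "k2 > 0"
      and "homomorphic_image (G l1 m1 k1) (G l2 m2 k2)"
      and "homomorphic_image (G l2 m2 k2) (G l1 m1 k1)"
      and "\<bar>l1\<bar> > m1 \<or> \<bar>l2\<bar> > m2"
  shows "l1 = l2 \<and> m1 = m2"
proof -
  define r1 r2 :: rat where "r1 = of_int l1 / of_int m1" and "r2 = of_int l2 / of_int m2"
  have l: "of_int l1 = r1 * of_int m1" "of_int l2 = r2 * of_int m2"
    using assms by (simp_all add: r1_def r2_def)
  have abs1: "1 < \<bar>r1\<bar> \<longleftrightarrow> m1 < \<bar>l1\<bar>" and abs2: "1 < \<bar>r2\<bar> \<longleftrightarrow> m2 < \<bar>l2\<bar>"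
    using assms by (simp_all add: r1_def r2_def abs_divide less_divide_eq) linarith+
  have unit1: "\<bar>r1\<bar> = 1" if "\<not> m1 < \<bar>l1\<bar>"
    using that assms by (simp add: r1_def abs_divide)
  have unit2: "\<bar>r2\<bar> = 1" if "\<not> m2 < \<bar>l2\<bar>"
    using that assms by (simp add: r2_def abs_divide)
  have nz: "l1 \<noteq> 0" "l2 \<noteq> 0" using assms by auto
  have ratio2: "\<exists>j. r2 = r1 powi j" if "m2 < \<bar>l2\<bar>"
    using epi_exponent_ratio[OF assms(7) nz(1)] that assms unfolding r1_def[symmetric]
    by (auto simp: r2_def)
  have ratio1: "\<exists>j. r1 = r2 powi j" if "m1 < \<bar>l1\<bar>"
    using epi_exponent_ratio[OF assms(8) nz(2)] that assms unfolding r2_def[symmetric]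
    by (auto simp: r1_def)
  \<comment> \<open>A ratio of absolute value 1 has only powers of absolute value 1, so the strict
    inequality for one group passes to the other.\<close>
  have both: "m1 < \<bar>l1\<bar>" "m2 < \<bar>l2\<bar>"
  proof -
    have "m1 < \<bar>l1\<bar>" if *: "m2 < \<bar>l2\<bar>"
    proof (rule ccontr)
      assume "\<not> m1 < \<bar>l1\<bar>"
      moreover obtain j where "r2 = r1 powi j" using ratio2[OF *] by blast
      ultimately show False using unit1 abs2 * by (simp add: power_int_abs)
    qed
    moreover have "m2 < \<bar>l2\<bar>" if *: "m1 < \<bar>l1\<bar>"
    proof (rule ccontr)
      assume "\<not> m2 < \<bar>l2\<bar>"
      moreover obtain j where "r1 = r2 powi j" using ratio1[OF *] by blast
      ultimately show False using unit2 abs1 * by (simp add: power_int_abs)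
    qed
    ultimately show "m1 < \<bar>l1\<bar>" "m2 < \<bar>l2\<bar>" using assms(9) by blast+
  qed
  obtain i where i: "r2 = r1 powi i" using ratio2 both by blast
  obtain j where j: "r1 = r2 powi j" using ratio1 both by blast
  \<comment> \<open>The ratios may be negative, so mutual powers are compared in absolute value; the
    exponent 1 then gives equality including the sign.\<close>
  have "i = 1"
  proof (rule powi_mutual_unit)
    show "1 < \<bar>r1\<bar>" "1 < \<bar>r2\<bar>" using abs1 abs2 both by blast+
    show "\<bar>r2\<bar> = \<bar>r1\<bar> powi i" by (simp add: i power_int_abs)
    show "\<bar>r1\<bar> = \<bar>r2\<bar> powi j" by (subst j) (rule power_int_abs)
  qed
  then have r: "r2 = r1" using i by simp
  have "l1 - m1 dvd l2 - m2" "l2 - m2 dvd l1 - m1"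
    using epi_abelianisation assms(7,8) by blast+
  then have "\<bar>l1 - m1\<bar> = \<bar>l2 - m2\<bar>" by (rule zdvd_antisym_abs)
  then have "\<bar>of_int l1 - of_int m1 :: rat\<bar> = \<bar>of_int l2 - of_int m2\<bar>"
    by (simp only: of_int_abs[symmetric] of_int_diff[symmetric])
  \<comment> \<open>The common ratio turns each difference l - m into (r1 - 1) m, and the nonzero
    factor r1 - 1 cancels.\<close>
  then have "\<bar>(r1 - 1) * of_int m1\<bar> = \<bar>(r1 - 1) * of_int m2\<bar>"
    unfolding l r by (simp only: left_diff_distrib mult_1)
  moreover have "r1 \<noteq> 1" using abs1 both by auto
  ultimately have "m1 = m2" using assms by (simp add: abs_mult)
  moreover have "l1 = l2" using l r \<open>m1 = m2\<close> by (metis of_int_eq_iff)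
  ultimately show ?thesis by blast
qed

end
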